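(* Let $R$ be a $G$-graded ring such that $\mathrm{Spec}_G(R)$ with the Zariski topology is a Noetherian topological space. Then every graded radical ideal $I$ of $R$ is the intersection of a finite number of minimal graded prime divisors of $I$.
   Context: $G$ is an abelian group with identity $e$; all rings are commutative with unity $1$. A $G$-graded ring is a ring $R=\bigoplus_{g\in G}R_g$ with additive subgroups $R_g$ satisfying $R_gR_h\subseteq R_{gh}$; $h(R)=\bigcup_{g}R_g$. An ideal $I$ of $R$ is graded ($I\lhd_G R$) if $I=\bigoplus_g (I\cap R_g)$. A graded prime ideal is a proper graded ideal $p$ such that for $a,b\in h(R)$, $ab\in p$ implies $a\in p$ or $b\in p$; $\mathrm{Spec}_G(R)$ is the set of all graded prime ideals. For $J\lhd_G R$ put $V_G^R(J)=\{p\in \mathrm{Spec}_G(R): J\subseteq p\}$; these are the closed sets of the Zariski topology on $\mathrm{Spec}_G(R)$. The graded radical $Gr(I)$ of $I\lhd_G R$ is the set of all $a=\sum_g a_g\in R$ (with $a_g\in R_g$) such that for each $g$ there is $n_g>0$ with $a_g^{n_g}\in I$; $I$ is a graded radical ideal if $I=Gr(I)$. A minimal graded prime divisor of $I$ is a $p\in V_G^R(I)$ such that whenever $J\in\mathrm{Spec}_G(R)$ and $I\subseteq J\subseteq p$, then $J=p$. A topological space is Noetherian if its closed sets satisfy the descending chain condition. Convention: the ideal $I=R$ is regarded as the intersection of the empty family of graded prime divisors. *)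

theory Defs
  imports "HOL-Algebra.Ideal" "HOL-Analysis.Abstract_Topology"
begin

section \<open>Internal direct sums\<close>

text \<open>
  \<open>direct_sum_decomp R S B x f\<close>: the family \<open>f\<close> (with \<open>f g \<in> B g\<close> for \<open>g \<in> S\<close> and only
  finitely many non-zero values) has sum \<open>x\<close>.  Membership in \<open>Pi\<^sub>E\<close> makes the family
  \<open>undefined\<close> outside the index set, so that uniqueness of decompositions can be expressed
  as equality of functions.
\<close>

definition direct_sum_decomp ::
    "('r, 'n) ring_scheme \<Rightarrow> 'g set \<Rightarrow> ('g \<Rightarrow> 'r set) \<Rightarrow> 'r \<Rightarrow> ('g \<Rightarrow> 'r) \<Rightarrow> bool" where
  "direct_sum_decomp R S B x f \<longleftrightarrow>
     f \<in> Pi\<^sub>E S B \<and>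
     finite {g \<in> S. f g \<noteq> \<zero>\<^bsub>R\<^esub>} \<and>
     x = finsum R f {g \<in> S. f g \<noteq> \<zero>\<^bsub>R\<^esub>}"

text \<open>\<open>internal_direct_sum R S B M\<close> expresses \<open>M = \<Oplus>\<^bsub>g \<in> S\<^esub> B g\<close> inside the additive group of \<open>R\<close>.\<close>

definition internal_direct_sum ::
    "('r, 'n) ring_scheme \<Rightarrow> 'g set \<Rightarrow> ('g \<Rightarrow> 'r set) \<Rightarrow> 'r set \<Rightarrow> bool" where
  "internal_direct_sum R S B M \<longleftrightarrow>
     (\<forall>g\<in>S. additive_subgroup (B g) R) \<and>
     M = {x. \<exists>f. direct_sum_decomp R S B x f} \<and>
     (\<forall>x\<in>M. \<exists>!f. direct_sum_decomp R S B x f)"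


section \<open>Graded rings, graded ideals and the graded spectrum\<close>

locale graded_ring = R: cring R + G: comm_group G
  for G :: "('g, 'm) monoid_scheme"
    and R :: "('r, 'n) ring_scheme"
    and A :: "'g \<Rightarrow> 'r set" +
  assumes direct_sum: "internal_direct_sum R (carrier G) A (carrier R)"
    and mult_mem: "\<lbrakk>g \<in> carrier G; h \<in> carrier G; a \<in> A g; b \<in> A h\<rbrakk>
                     \<Longrightarrow> a \<otimes>\<^bsub>R\<^esub> b \<in> A (g \<otimes>\<^bsub>G\<^esub> h)"

definition homogeneous :: "('g, 'm) monoid_scheme \<Rightarrow> ('g \<Rightarrow> 'r set) \<Rightarrow> 'r set" where
  "homogeneous G A = (\<Union>g\<in>carrier G. A g)"

definition component ::
    "('g, 'm) monoid_scheme \<Rightarrow> ('r, 'n) ring_scheme \<Rightarrow> ('g \<Rightarrow> 'r set) \<Rightarrow> 'r \<Rightarrow> 'g \<Rightarrow> 'r" where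
  "component G R A x = (THE f. direct_sum_decomp R (carrier G) A x f)"

definition graded_ideal ::
    "('g, 'm) monoid_scheme \<Rightarrow> ('r, 'n) ring_scheme \<Rightarrow> ('g \<Rightarrow> 'r set) \<Rightarrow> 'r set \<Rightarrow> bool" where
  "graded_ideal G R A I \<longleftrightarrow>
     ideal I R \<and> internal_direct_sum R (carrier G) (\<lambda>g. I \<inter> A g) I"

definition graded_prime_ideal ::
    "('g, 'm) monoid_scheme \<Rightarrow> ('r, 'n) ring_scheme \<Rightarrow> ('g \<Rightarrow> 'r set) \<Rightarrow> 'r set \<Rightarrow> bool" where
  "graded_prime_ideal G R A p \<longleftrightarrow>
     graded_ideal G R A p \<and> p \<noteq> carrier R \<and>
     (\<forall>a\<in>homogeneous G A. \<forall>b\<in>homogeneous G A. a \<otimes>\<^bsub>R\<^esub> b \<in> p \<longrightarrow> a \<in> p \<or> b \<in> p)"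

definition graded_Spec ::
    "('g, 'm) monoid_scheme \<Rightarrow> ('r, 'n) ring_scheme \<Rightarrow> ('g \<Rightarrow> 'r set) \<Rightarrow> 'r set set" where
  "graded_Spec G R A = {p. graded_prime_ideal G R A p}"

definition graded_V ::
    "('g, 'm) monoid_scheme \<Rightarrow> ('r, 'n) ring_scheme \<Rightarrow> ('g \<Rightarrow> 'r set) \<Rightarrow> 'r set \<Rightarrow> 'r set set" where
  "graded_V G R A J = {p \<in> graded_Spec G R A. J \<subseteq> p}"

text \<open>
  The closed sets are the \<open>graded_V G R A J\<close> for graded ideals \<open>J\<close>; that this is a topology is
  shown in \<open>closedin_zariski_topology\<close> below.
\<close>

definition zariski_topology ::
    "('g, 'm) monoid_scheme \<Rightarrow> ('r, 'n) ring_scheme \<Rightarrow> ('g \<Rightarrow> 'r set) \<Rightarrow> 'r set topology" where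
  "zariski_topology G R A =
     topology (\<lambda>U. \<exists>J. graded_ideal G R A J \<and> U = graded_Spec G R A - graded_V G R A J)"

definition noetherian_space :: "'a topology \<Rightarrow> bool" where
  "noetherian_space X \<longleftrightarrow>
     (\<forall>C :: nat \<Rightarrow> 'a set.
        (\<forall>n. closedin X (C n)) \<longrightarrow> (\<forall>n. C (Suc n) \<subseteq> C n) \<longrightarrow>
        (\<exists>N. \<forall>n\<ge>N. C n = C N))"

definition graded_radical ::
    "('g, 'm) monoid_scheme \<Rightarrow> ('r, 'n) ring_scheme \<Rightarrow> ('g \<Rightarrow> 'r set) \<Rightarrow> 'r set \<Rightarrow> 'r set" where
  "graded_radical G R A I =
     {a \<in> carrier R. \<forall>g\<in>carrier G. \<exists>n::nat. n > 0 \<and> component G R A a g [^]\<^bsub>R\<^esub> n \<in> I}"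

definition graded_radical_ideal ::
    "('g, 'm) monoid_scheme \<Rightarrow> ('r, 'n) ring_scheme \<Rightarrow> ('g \<Rightarrow> 'r set) \<Rightarrow> 'r set \<Rightarrow> bool" where
  "graded_radical_ideal G R A I \<longleftrightarrow> graded_ideal G R A I \<and> I = graded_radical G R A I"

definition minimal_graded_prime_divisor ::
    "('g, 'm) monoid_scheme \<Rightarrow> ('r, 'n) ring_scheme \<Rightarrow> ('g \<Rightarrow> 'r set) \<Rightarrow> 'r set \<Rightarrow> 'r set \<Rightarrow> bool" where
  "minimal_graded_prime_divisor G R A I p \<longleftrightarrow>
     p \<in> graded_V G R A I \<and>
     (\<forall>J\<in>graded_Spec G R A. I \<subseteq> J \<and> J \<subseteq> p \<longrightarrow> J = p)"


section \<open>The Zariski topology is well defined\<close>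

lemma finsum_in_ideal:
  assumes "ideal I R" "finite S" "\<And>g. g \<in> S \<Longrightarrow> f g \<in> I"
  shows "finsum R f S \<in> I"
proof -
  interpret ideal I R by fact
  show ?thesis
    using assms(2,3)
  proof (induction S rule: finite_induct)
    case empty
    show ?case by simp
  next
    case (insert g S)
    have "finsum R f (insert g S) = f g \<oplus>\<^bsub>R\<^esub> finsum R f S"
      using insert by (intro finsum_insert) (auto intro: a_Hcarr)
    with insert show ?case by simp
  qed
qed

context graded_ring
begin

lemma decomp_carrier:
  assumes "direct_sum_decomp R (carrier G) A x f"
  shows "x \<in> carrier R"
proof -
  have "carrier R = {x. \<exists>f. direct_sum_decomp R (carrier G) A x f}"
    using direct_sum unfolding internal_direct_sum_def by (elim conjE)
  also have "x \<in> \<dots>" using assms by blast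
  finally show ?thesis .
qed

lemma decomp_ex1:
  assumes "x \<in> carrier R"
  shows "\<exists>!f. direct_sum_decomp R (carrier G) A x f"
  using direct_sum assms unfolding internal_direct_sum_def by (elim conjE) (rule bspec)

lemma additive_subgroup_piece: "g \<in> carrier G \<Longrightarrow> additive_subgroup (A g) R"
  using direct_sum unfolding internal_direct_sum_def by (elim conjE) (rule bspec)

lemma decomp_component:
  assumes "x \<in> carrier R"
  shows "direct_sum_decomp R (carrier G) A x (component G R A x)"
  unfolding component_def by (rule theI'[OF decomp_ex1[OF assms]])

lemma component_eqI:
  assumes "direct_sum_decomp R (carrier G) A x f"
  shows "component G R A x = f"
  unfolding component_def by (rule the1_equality[OF decomp_ex1[OF decomp_carrier[OF assms]]]) (rule assms)

lemma component_mem: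
  assumes "x \<in> carrier R" "g \<in> carrier G"
  shows "component G R A x g \<in> A g"
  using decomp_component[OF assms(1)] assms(2)
  unfolding direct_sum_decomp_def by (auto simp: PiE_iff)

lemma graded_ideal_iff:
  "graded_ideal G R A I \<longleftrightarrow>
     ideal I R \<and> (\<forall>x\<in>I. \<forall>g\<in>carrier G. component G R A x g \<in> I)"
proof (intro iffI conjI ballI)
  assume gr: "graded_ideal G R A I"
  show "ideal I R" using gr by (simp add: graded_ideal_def)
  fix x g assume x: "x \<in> I" and g: "g \<in> carrier G"
  have "\<exists>!f. direct_sum_decomp R (carrier G) (\<lambda>g. I \<inter> A g) x f"
    using gr x unfolding graded_ideal_def internal_direct_sum_def
    by (elim conjE) (rule bspec)
  then obtain f where f: "direct_sum_decomp R (carrier G) (\<lambda>g. I \<inter> A g) x f" by blast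
  then have "direct_sum_decomp R (carrier G) A x f"
    unfolding direct_sum_decomp_def by (auto simp: PiE_iff)
  then have "component G R A x = f" by (rule component_eqI)
  with f g show "component G R A x g \<in> I"
    unfolding direct_sum_decomp_def by (auto simp: PiE_iff)
next
  assume *: "ideal I R \<and> (\<forall>x\<in>I. \<forall>g\<in>carrier G. component G R A x g \<in> I)"
  then interpret ideal I R by simp
  have sub: "additive_subgroup (I \<inter> A g) R" if "g \<in> carrier G" for g
  proof -
    have "additive_subgroup (A g) R"
      using that by (rule additive_subgroup_piece)
    then show ?thesis
      using additive_subgroup_axioms
      by (auto simp: additive_subgroup_def intro: group.subgroups_Inter_pair[OF R.a_group])
  qed
  have dec: "direct_sum_decomp R (carrier G) (\<lambda>g. I \<inter> A g) x (component G R A x)"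
    if "x \<in> I" for x
  proof -
    have "direct_sum_decomp R (carrier G) A x (component G R A x)"
      using that by (intro decomp_component) (auto intro: a_Hcarr)
    then show ?thesis
      using * that unfolding direct_sum_decomp_def by (auto simp: PiE_iff)
  qed
  have mem: "x \<in> I" and uniq: "f = component G R A x"
    if f: "direct_sum_decomp R (carrier G) (\<lambda>g. I \<inter> A g) x f" for x f
  proof -
    show "x \<in> I"
      using f finsum_in_ideal[OF ideal_axioms, of "{g \<in> carrier G. f g \<noteq> \<zero>\<^bsub>R\<^esub>}" f]
      unfolding direct_sum_decomp_def by (auto simp: PiE_iff)
    have "direct_sum_decomp R (carrier G) A x f"
      using f unfolding direct_sum_decomp_def by (auto simp: PiE_iff)
    then show "f = component G R A x" by (simp add: component_eqI)
  qed
  show "graded_ideal G R A I"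
    unfolding graded_ideal_def internal_direct_sum_def
  proof (intro conjI ballI ex_ex1I)
    show "ideal I R" by (rule ideal_axioms)
    show "I = {x. \<exists>f. direct_sum_decomp R (carrier G) (\<lambda>g. I \<inter> A g) x f}"
      using dec mem by blast
  next
    fix x f f'
    assume "direct_sum_decomp R (carrier G) (\<lambda>g. I \<inter> A g) x f"
      and "direct_sum_decomp R (carrier G) (\<lambda>g. I \<inter> A g) x f'"
    then show "f = f'" using uniq[of x f] uniq[of x f'] by simp
  qed (use sub dec in blast)+
qed

lemma graded_ideal_carrier: "graded_ideal G R A (carrier R)"
proof -
  have "A g \<subseteq> carrier R" if "g \<in> carrier G" for g
    using that by (rule additive_subgroup.a_subset[OF additive_subgroup_piece])
  then show ?thesis
    using R.oneideal component_mem by (auto simp: graded_ideal_iff)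
qed

lemma graded_ideal_Inter:
  assumes "\<J> \<noteq> {}" "\<And>J. J \<in> \<J> \<Longrightarrow> graded_ideal G R A J"
  shows "graded_ideal G R A (\<Inter>\<J>)"
  using assms R.i_Intersect[of \<J>] by (auto simp: graded_ideal_iff)

lemma obtain_component_notin:
  assumes "x \<in> carrier R" "ideal p R" "x \<notin> p"
  obtains g where "g \<in> carrier G" "component G R A x g \<notin> p"
proof -
  define f where "f = component G R A x"
  have dec: "direct_sum_decomp R (carrier G) A x f"
    unfolding f_def by (rule decomp_component[OF assms(1)])
  have "\<exists>g\<in>carrier G. f g \<notin> p"
  proof (rule ccontr)
    assume "\<not> ?thesis"
    then have "finsum R f {g \<in> carrier G. f g \<noteq> \<zero>\<^bsub>R\<^esub>} \<in> p"
      using dec by (intro finsum_in_ideal[OF assms(2)]) (auto simp: direct_sum_decomp_def)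
    then show False
      using dec assms(3) by (simp add: direct_sum_decomp_def)
  qed
  then show ?thesis using that by (auto simp: f_def)
qed

lemma graded_V_Int:
  assumes I: "graded_ideal G R A I" and J: "graded_ideal G R A J"
  shows "graded_V G R A (I \<inter> J) = graded_V G R A I \<union> graded_V G R A J"
proof -
  have "I \<subseteq> p \<or> J \<subseteq> p" if p: "graded_prime_ideal G R A p" and sub: "I \<inter> J \<subseteq> p" for p
  proof (rule ccontr)
    assume "\<not> (I \<subseteq> p \<or> J \<subseteq> p)"
    then obtain a b where a: "a \<in> I" "a \<notin> p" and b: "b \<in> J" "b \<notin> p" by blast
    interpret I: ideal I R using I by (simp add: graded_ideal_def)
    interpret J: ideal J R using J by (simp add: graded_ideal_def)
    have idp: "ideal p R" using p by (simp add: graded_prime_ideal_def graded_ideal_def)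
    have ca: "a \<in> carrier R" and cb: "b \<in> carrier R"
      using I.a_Hcarr[OF a(1)] J.a_Hcarr[OF b(1)] .
    obtain g where g: "g \<in> carrier G" "component G R A a g \<notin> p"
      using obtain_component_notin[OF ca idp a(2)] by blast
    obtain h where h: "h \<in> carrier G" "component G R A b h \<notin> p"
      using obtain_component_notin[OF cb idp b(2)] by blast
    let ?a = "component G R A a g" and ?b = "component G R A b h"
    have aI: "?a \<in> I" and bJ: "?b \<in> J"
      using I J a b g h by (auto simp: graded_ideal_iff)
    then have "?a \<otimes>\<^bsub>R\<^esub> ?b \<in> I \<inter> J"
      using I.I_r_closed[OF aI J.a_Hcarr[OF bJ]] J.I_l_closed[OF bJ I.a_Hcarr[OF aI]] by blast
    with sub have "?a \<otimes>\<^bsub>R\<^esub> ?b \<in> p" by blast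
    moreover have "?a \<in> homogeneous G A" "?b \<in> homogeneous G A"
      using component_mem ca cb g(1) h(1) by (auto simp: homogeneous_def)
    ultimately show False using p g h by (auto simp: graded_prime_ideal_def)
  qed
  then show ?thesis unfolding graded_V_def graded_Spec_def by blast
qed

lemma graded_V_Union:
  assumes "\<And>J. J \<in> \<J> \<Longrightarrow> graded_ideal G R A J"
  obtains K where "graded_ideal G R A K"
    "graded_V G R A K = graded_Spec G R A \<inter> (\<Inter>J\<in>\<J>. graded_V G R A J)"
proof -
  define K where "K = \<Inter>{K. graded_ideal G R A K \<and> \<Union>\<J> \<subseteq> K}"
  have "J \<subseteq> carrier R" if "J \<in> \<J>" for J
    using assms[OF that] unfolding graded_ideal_def
    by (meson additive_subgroup.a_subset ideal.axioms(1))
  then have "carrier R \<in> {K. graded_ideal G R A K \<and> \<Union>\<J> \<subseteq> K}"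
    using graded_ideal_carrier by blast
  then have gr: "graded_ideal G R A K"
    unfolding K_def by (intro graded_ideal_Inter) auto
  have *: "K \<subseteq> p \<longleftrightarrow> (\<forall>J\<in>\<J>. J \<subseteq> p)" if "p \<in> graded_Spec G R A" for p
  proof -
    have "graded_ideal G R A p"
      using that by (simp add: graded_Spec_def graded_prime_ideal_def)
    then show ?thesis unfolding K_def by blast
  qed
  have "p \<in> graded_V G R A K \<longleftrightarrow> p \<in> graded_Spec G R A \<inter> (\<Inter>J\<in>\<J>. graded_V G R A J)" for p
    using *[of p] by (auto simp: graded_V_def)
  then have "graded_V G R A K = graded_Spec G R A \<inter> (\<Inter>J\<in>\<J>. graded_V G R A J)"
    by (rule Set.set_eqI)
  with gr show ?thesis by (rule that)
qed

lemma istopology_zariski: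
  "istopology (\<lambda>U. \<exists>J. graded_ideal G R A J \<and> U = graded_Spec G R A - graded_V G R A J)"
  (is "istopology ?open")
  unfolding istopology_def
proof (intro conjI allI impI)
  fix U V assume "?open U" "?open V"
  then obtain I J where IJ: "graded_ideal G R A I" "graded_ideal G R A J"
    "U = graded_Spec G R A - graded_V G R A I" "V = graded_Spec G R A - graded_V G R A J" by blast
  then have "graded_ideal G R A (I \<inter> J)"
    using graded_ideal_Inter[of "{I, J}"] by auto
  moreover have "U \<inter> V = graded_Spec G R A - graded_V G R A (I \<inter> J)"
    using IJ graded_V_Int by auto
  ultimately show "?open (U \<inter> V)" by blast
next
  fix \<U> assume op: "\<forall>U\<in>\<U>. ?open U"
  define \<J> where "\<J> = {J. graded_ideal G R A J \<and> graded_Spec G R A - graded_V G R A J \<in> \<U>}"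
  obtain K where K: "graded_ideal G R A K"
    "graded_V G R A K = graded_Spec G R A \<inter> (\<Inter>J\<in>\<J>. graded_V G R A J)"
  proof (rule graded_V_Union)
    show "graded_ideal G R A J" if "J \<in> \<J>" for J using that by (simp add: \<J>_def)
  qed
  have "\<U> = (\<lambda>J. graded_Spec G R A - graded_V G R A J) ` \<J>"
  proof (intro equalityI subsetI)
    fix U assume U: "U \<in> \<U>"
    then obtain J where "graded_ideal G R A J" "U = graded_Spec G R A - graded_V G R A J"
      using op by blast
    with U show "U \<in> (\<lambda>J. graded_Spec G R A - graded_V G R A J) ` \<J>"
      by (intro image_eqI[of _ _ J]) (simp_all add: \<J>_def)
  qed (auto simp: \<J>_def)
  then have "\<Union>\<U> = (\<Union>J\<in>\<J>. graded_Spec G R A - graded_V G R A J)" by simp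
  also have "\<dots> = graded_Spec G R A - graded_V G R A K"
    unfolding K(2) by blast
  finally have "\<Union>\<U> = graded_Spec G R A - graded_V G R A K" .
  with K(1) show "?open (\<Union>\<U>)" by (intro exI conjI)
qed

lemma openin_zariski_topology:
  "openin (zariski_topology G R A) U \<longleftrightarrow>
     (\<exists>J. graded_ideal G R A J \<and> U = graded_Spec G R A - graded_V G R A J)"
  unfolding zariski_topology_def topology_inverse'[OF istopology_zariski] ..

lemma topspace_zariski_topology: "topspace (zariski_topology G R A) = graded_Spec G R A"
proof
  show "topspace (zariski_topology G R A) \<subseteq> graded_Spec G R A"
    unfolding topspace_def openin_zariski_topology by blast
  have "graded_V G R A (carrier R) = {}"
    unfolding graded_V_def graded_Spec_def graded_prime_ideal_def graded_ideal_def
    using additive_subgroup.a_subset ideal.axioms(1) by fastforce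
  then have "openin (zariski_topology G R A) (graded_Spec G R A)"
    unfolding openin_zariski_topology using graded_ideal_carrier by blast
  then show "graded_Spec G R A \<subseteq> topspace (zariski_topology G R A)"
    by (rule openin_subset)
qed

lemma closedin_zariski_topology:
  "closedin (zariski_topology G R A) C \<longleftrightarrow> (\<exists>J. graded_ideal G R A J \<and> C = graded_V G R A J)"
proof -
  have "C \<subseteq> graded_Spec G R A \<and> graded_Spec G R A - C = graded_Spec G R A - graded_V G R A J
          \<longleftrightarrow> C = graded_V G R A J" for J
    by (auto simp: graded_V_def)
  then show ?thesis
    unfolding closedin_def topspace_zariski_topology openin_zariski_topology
    by metis
qed

end

end

theory Submission
  imports Defs "HOL-Algebra.Ring_Divisibility"
begin

text \<open>
  A graded radical ideal is the intersection of all graded primes containing it: a graded ideal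
  maximal among those avoiding the positive powers of a homogeneous element is graded prime.
  By Noetherian induction on closed sets, every closed \<open>C\<close> contains finitely many primes below all
  its members: either \<open>\<Inter>C\<close> is itself graded prime, or homogeneous \<open>a\<close>, \<open>b\<close> outside \<open>\<Inter>C\<close> with
  product in \<open>\<Inter>C\<close> split \<open>C\<close> into two strictly smaller closed sets. For \<open>C = V(I)\<close>, the
  inclusion-minimal ones among these finitely many primes are minimal graded prime divisors of \<open>I\<close>
  and have the same intersection as \<open>V(I)\<close>.
\<close>

context graded_ring
begin

section \<open>Components of sums and of products with a homogeneous factor\<close>

lemma piece_closed: "\<lbrakk>g \<in> carrier G; a \<in> A g\<rbrakk> \<Longrightarrow> a \<in> carrier R"
  using additive_subgroup.a_subset[OF additive_subgroup_piece] by blast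

text \<open>Extended by zero, the family \<open>f\<close> is a decomposition of its sum, and
  decompositions are unique.\<close>

lemma component_finsum:
  assumes S: "finite S" "S \<subseteq> carrier G" and f: "\<And>g. g \<in> S \<Longrightarrow> f g \<in> A g"
    and g: "g \<in> carrier G"
  shows "component G R A (finsum R f S) g = (if g \<in> S then f g else \<zero>\<^bsub>R\<^esub>)"
proof -
  \<comment> \<open>Restricting to \<open>carrier G\<close> makes \<open>f'\<close>
    \<open>undefined\<close> elsewhere, as \<open>Pi\<^sub>E\<close> demands.\<close>
  define f' where "f' = (\<lambda>g\<in>carrier G. if g \<in> S then f g else \<zero>\<^bsub>R\<^esub>)"
  have supp: "{g \<in> carrier G. f' g \<noteq> \<zero>\<^bsub>R\<^esub>} \<subseteq> S"
    by (auto simp: f'_def)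
  have "finsum R f S = finsum R f' {g \<in> carrier G. f' g \<noteq> \<zero>\<^bsub>R\<^esub>}"
    using S f supp
    by (intro R.add.finprod_mono_neutral_cong_right) (auto simp: f'_def intro: piece_closed)
  moreover have "f' \<in> Pi\<^sub>E (carrier G) A"
    using f additive_subgroup.zero_closed[OF additive_subgroup_piece] by (auto simp: f'_def)
  ultimately have "direct_sum_decomp R (carrier G) A (finsum R f S) f'"
    using finite_subset[OF supp S(1)] by (simp add: direct_sum_decomp_def)
  then show ?thesis
    using g by (simp add: component_eqI f'_def)
qed

lemma finsum_component:
  assumes "x \<in> carrier R"
  obtains S where "finite S" "S \<subseteq> carrier G" "x = finsum R (component G R A x) S"
    "\<And>g. \<lbrakk>g \<in> carrier G; g \<notin> S\<rbrakk> \<Longrightarrow> component G R A x g = \<zero>\<^bsub>R\<^esub>"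
  using decomp_component[OF assms] that[of "{g \<in> carrier G. component G R A x g \<noteq> \<zero>\<^bsub>R\<^esub>}"]
  unfolding direct_sum_decomp_def by blast

text \<open>Multiplying by \<open>c\<close> shifts every degree by \<open>h\<close>. Translation by
  \<open>h\<close> is injective, so no two shifted components land in the same degree.\<close>

lemma component_mult_homogeneous:
  assumes x: "x \<in> carrier R" and h: "h \<in> carrier G" "c \<in> A h" and g: "g \<in> carrier G"
  shows "component G R A (x \<otimes>\<^bsub>R\<^esub> c) (g \<otimes>\<^bsub>G\<^esub> h) = component G R A x g \<otimes>\<^bsub>R\<^esub> c"
proof -
  let ?f = "component G R A x" and ?t = "\<lambda>g. g \<otimes>\<^bsub>G\<^esub> h"
  have cc: "c \<in> carrier R" using h by (rule piece_closed)
  have fc: "?f k \<in> carrier R" if "k \<in> carrier G" for k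
    using that x by (blast intro: piece_closed component_mem)
  obtain S where S: "finite S" "S \<subseteq> carrier G" "x = finsum R ?f S"
    and zero: "\<And>g. \<lbrakk>g \<in> carrier G; g \<notin> S\<rbrakk> \<Longrightarrow> ?f g = \<zero>\<^bsub>R\<^esub>"
    using finsum_component[OF x] by blast
  define f' where "f' k = ?f (k \<otimes>\<^bsub>G\<^esub> inv\<^bsub>G\<^esub> h) \<otimes>\<^bsub>R\<^esub> c" for k
  have f': "f' (?t k) = ?f k \<otimes>\<^bsub>R\<^esub> c" if "k \<in> carrier G" for k
    using that h(1) by (simp add: f'_def G.m_assoc)
  have inj: "inj_on ?t (carrier G)"
    using h(1) by (auto intro: inj_onI)
  have "x \<otimes>\<^bsub>R\<^esub> c = finsum R ?f S \<otimes>\<^bsub>R\<^esub> c" using S(3) by simp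
  also have "\<dots> = finsum R (\<lambda>k. ?f k \<otimes>\<^bsub>R\<^esub> c) S"
    using S cc fc by (intro R.finsum_ldistr) auto
  also have "\<dots> = finsum R (\<lambda>k. f' (?t k)) S"
    using S(2) fc cc f' by (intro R.finsum_cong') auto
  also have "\<dots> = finsum R f' (?t ` S)"
    using S(2) fc cc f' inj
    by (intro R.add.finprod_reindex[symmetric]) (auto intro: inj_on_subset)
  finally have "x \<otimes>\<^bsub>R\<^esub> c = finsum R f' (?t ` S)" .
  moreover have "component G R A (finsum R f' (?t ` S)) (?t g) =
      (if ?t g \<in> ?t ` S then f' (?t g) else \<zero>\<^bsub>R\<^esub>)"
  proof (rule component_finsum)
    show "f' k \<in> A k" if "k \<in> ?t ` S" for k
      using that S(2) h x f' by (auto intro!: mult_mem component_mem)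
  qed (use S h g in auto)
  moreover have "?t g \<in> ?t ` S \<longleftrightarrow> g \<in> S"
    using inj g S(2) by (rule inj_on_image_mem_iff)
  ultimately show ?thesis
    using f'[OF g] zero[OF g] cc by simp
qed

section \<open>Graded primes from Zorn's lemma\<close>

text \<open>For \<open>c\<close> of degree \<open>h\<close>, the product of \<open>c\<close> with
  the component of \<open>x\<close> in degree \<open>g\<close> is itself a component of the product
  of \<open>x\<close> and \<open>c\<close>, hence lies in \<open>J\<close>.\<close>

lemma graded_ideal_colon:
  assumes J: "graded_ideal G R A J" and c: "c \<in> homogeneous G A"
  shows "graded_ideal G R A {x \<in> carrier R. x \<otimes>\<^bsub>R\<^esub> c \<in> J}"
proof -
  obtain h where h: "h \<in> carrier G" "c \<in> A h"
    using c by (auto simp: homogeneous_def)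
  have cc: "c \<in> carrier R" using h by (rule piece_closed)
  interpret J: ideal J R using J by (simp add: graded_ideal_def)
  have "ideal {x \<in> carrier R. x \<otimes>\<^bsub>R\<^esub> c \<in> J} R"
  proof (rule idealI)
    show "subgroup {x \<in> carrier R. x \<otimes>\<^bsub>R\<^esub> c \<in> J} (add_monoid R)"
    proof (rule R.add.subgroupI)
      show "\<ominus>\<^bsub>R\<^esub> a \<in> {x \<in> carrier R. x \<otimes>\<^bsub>R\<^esub> c \<in> J}"
        if "a \<in> {x \<in> carrier R. x \<otimes>\<^bsub>R\<^esub> c \<in> J}" for a
        using that cc J.a_inv_closed by (auto simp: R.l_minus)
      have "\<zero>\<^bsub>R\<^esub> \<in> {x \<in> carrier R. x \<otimes>\<^bsub>R\<^esub> c \<in> J}"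
        using cc by simp
      then show "{x \<in> carrier R. x \<otimes>\<^bsub>R\<^esub> c \<in> J} \<noteq> {}" by blast
      show "a \<oplus>\<^bsub>R\<^esub> b \<in> {x \<in> carrier R. x \<otimes>\<^bsub>R\<^esub> c \<in> J}"
        if "a \<in> {x \<in> carrier R. x \<otimes>\<^bsub>R\<^esub> c \<in> J}" "b \<in> {x \<in> carrier R. x \<otimes>\<^bsub>R\<^esub> c \<in> J}" for a b
        using that cc by (simp add: R.l_distr)
    qed blast
  next
    fix a x assume "a \<in> {x \<in> carrier R. x \<otimes>\<^bsub>R\<^esub> c \<in> J}" and x: "x \<in> carrier R"
    then have a: "a \<in> carrier R" "a \<otimes>\<^bsub>R\<^esub> c \<in> J" by auto
    then show "x \<otimes>\<^bsub>R\<^esub> a \<in> {x \<in> carrier R. x \<otimes>\<^bsub>R\<^esub> c \<in> J}"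
      using x cc J.I_l_closed[OF a(2) x] by (simp add: R.m_assoc)
    then show "a \<otimes>\<^bsub>R\<^esub> x \<in> {x \<in> carrier R. x \<otimes>\<^bsub>R\<^esub> c \<in> J}"
      using a x by (simp add: R.m_comm)
  qed (rule R.ring_axioms)
  moreover have "component G R A x g \<in> {x \<in> carrier R. x \<otimes>\<^bsub>R\<^esub> c \<in> J}"
    if x: "x \<in> carrier R" "x \<otimes>\<^bsub>R\<^esub> c \<in> J" and g: "g \<in> carrier G" for x g
  proof -
    have "component G R A (x \<otimes>\<^bsub>R\<^esub> c) (g \<otimes>\<^bsub>G\<^esub> h) \<in> J"
      using J x(2) h(1) g by (simp add: graded_ideal_iff)
    then show ?thesis
      using piece_closed[OF g component_mem[OF x(1) g]] x(1) g h
      by (simp add: component_mult_homogeneous)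
  qed
  ultimately show ?thesis unfolding graded_ideal_iff by blast
qed

lemma homogeneous_mult:
  "\<lbrakk>a \<in> homogeneous G A; b \<in> homogeneous G A\<rbrakk> \<Longrightarrow> a \<otimes>\<^bsub>R\<^esub> b \<in> homogeneous G A"
  unfolding homogeneous_def by (auto intro: mult_mem G.m_closed)

lemma homogeneous_closed: "a \<in> homogeneous G A \<Longrightarrow> a \<in> carrier R"
  by (auto simp: homogeneous_def intro: piece_closed)

text \<open>Writing exponents as \<open>Suc n\<close> gives exactly the positive powers that occur
  in the graded radical.\<close>

lemma homogeneous_pow_Suc:
  assumes "a \<in> homogeneous G A"
  shows "a [^]\<^bsub>R\<^esub> Suc n \<in> homogeneous G A"
proof (induction n)
  case 0
  show ?case using assms homogeneous_closed by simp
next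
  case (Suc n)
  then show ?case using assms homogeneous_mult by (subst R.nat_pow_Suc) blast
qed

text \<open>Gradedness is a condition on the components of one element at a time, and each element
  of the union lies in a single member of the chain.\<close>

lemma graded_ideal_chain_Union:
  assumes C: "subset.chain {J. graded_ideal G R A J} \<C>" and ne: "\<C> \<noteq> {}"
  shows "graded_ideal G R A (\<Union>\<C>)"
proof -
  have gr: "graded_ideal G R A J" if "J \<in> \<C>" for J
    using C that by (auto simp: subset.chain_def)
  have "subset.chain {J. ideal J R} \<C>"
    using C unfolding subset.chain_def graded_ideal_def by blast
  then have "ideal (\<Union>\<C>) R"
    using R.chain_Union_is_ideal[of \<C>] ne by simp
  then show ?thesis
    using gr by (auto simp: graded_ideal_iff)
qed

text \<open>Take \<open>p\<close> maximal. If \<open>b\<close> and \<open>c\<close> lie outside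
  \<open>p\<close> but their product lies in \<open>p\<close>, then passing to a colon ideal twice
  puts a positive power of \<open>a\<close> into \<open>p\<close>.\<close>

lemma graded_prime_avoiding_powers:
  assumes I: "graded_ideal G R A I" and a: "a \<in> homogeneous G A"
    and avoid: "\<And>n. a [^]\<^bsub>R\<^esub> Suc n \<notin> I"
  obtains p where "graded_prime_ideal G R A p" "I \<subseteq> p" "a \<notin> p"
proof -
  define \<A> where "\<A> = {J. graded_ideal G R A J \<and> I \<subseteq> J \<and> (\<forall>n. a [^]\<^bsub>R\<^esub> Suc n \<notin> J)}"
  have ca: "a \<in> carrier R" using a by (rule homogeneous_closed)
  have "\<exists>M\<in>\<A>. \<forall>X\<in>\<A>. M \<subseteq> X \<longrightarrow> X = M"
  proof (rule subset_Zorn_nonempty)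
    show "\<A> \<noteq> {}" using I avoid by (auto simp: \<A>_def)
    fix \<C> assume ne: "\<C> \<noteq> {}" and ch: "subset.chain \<A> \<C>"
    then have "subset.chain {J. graded_ideal G R A J} \<C>"
      by (auto simp: subset.chain_def \<A>_def)
    then have "graded_ideal G R A (\<Union>\<C>)"
      using ne by (rule graded_ideal_chain_Union)
    then show "\<Union>\<C> \<in> \<A>"
      using ne ch unfolding \<A>_def subset.chain_def by blast
  qed
  then obtain p where p: "p \<in> \<A>" and max: "\<And>J. J \<in> \<A> \<Longrightarrow> p \<subseteq> J \<Longrightarrow> J = p" by blast
  have gr: "graded_ideal G R A p" and Ip: "I \<subseteq> p" and pa: "a [^]\<^bsub>R\<^esub> Suc n \<notin> p" for n
    using p by (auto simp: \<A>_def)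
  interpret p: ideal p R using gr by (simp add: graded_ideal_def)
  \<comment> \<open>Enlarging \<open>p\<close> to the colon ideal \<open>p : c\<close> replaces the usual \<open>p + (b)\<close>; it is graded because \<open>c\<close> is homogeneous.\<close>
  have pow_in_colon: "\<exists>n. a [^]\<^bsub>R\<^esub> Suc n \<otimes>\<^bsub>R\<^esub> c \<in> p"
    if c: "c \<in> homogeneous G A" and b: "b \<in> carrier R" "b \<notin> p" "b \<otimes>\<^bsub>R\<^esub> c \<in> p" for b c
  proof (rule ccontr)
    assume no: "\<nexists>n. a [^]\<^bsub>R\<^esub> Suc n \<otimes>\<^bsub>R\<^esub> c \<in> p"
    let ?K = "{x \<in> carrier R. x \<otimes>\<^bsub>R\<^esub> c \<in> p}"
    have "p \<subseteq> ?K"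
      using p.I_r_closed homogeneous_closed[OF c] p.a_subset by blast
    moreover have "?K \<in> \<A>"
      using calculation graded_ideal_colon[OF gr c] Ip no by (auto simp: \<A>_def)
    ultimately show False using max b by blast
  qed
  have "b \<in> p \<or> c \<in> p"
    if b: "b \<in> homogeneous G A" and c: "c \<in> homogeneous G A" and bc: "b \<otimes>\<^bsub>R\<^esub> c \<in> p" for b c
  proof (rule ccontr)
    assume no: "\<not> (b \<in> p \<or> c \<in> p)"
    obtain n where n: "a [^]\<^bsub>R\<^esub> Suc n \<otimes>\<^bsub>R\<^esub> c \<in> p"
      using pow_in_colon[OF c _ _ bc] no homogeneous_closed[OF b] by blast
    have pow: "a [^]\<^bsub>R\<^esub> Suc n \<in> homogeneous G A" using a by (rule homogeneous_pow_Suc)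
    \<comment> \<open>Second round: the colon is now taken by the power of \<open>a\<close>, and
      \<open>c\<close> is the element outside \<open>p\<close> that makes it strictly
      larger.\<close>
    have "c \<otimes>\<^bsub>R\<^esub> a [^]\<^bsub>R\<^esub> Suc n \<in> p"
      using n R.m_comm[OF homogeneous_closed[OF c] homogeneous_closed[OF pow]] by simp
    then obtain m where "a [^]\<^bsub>R\<^esub> Suc m \<otimes>\<^bsub>R\<^esub> a [^]\<^bsub>R\<^esub> Suc n \<in> p"
      using pow_in_colon[OF pow] no homogeneous_closed[OF c] by blast
    then have "a [^]\<^bsub>R\<^esub> Suc (m + Suc n) \<in> p"
      unfolding R.nat_pow_mult[OF ca] by simp
    then show False using pa by blast
  qed
  moreover have "a \<notin> p" using pa[of 0] ca by simp
  moreover have "p \<noteq> carrier R" using \<open>a \<notin> p\<close> ca by blast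
  ultimately show ?thesis
    using gr Ip by (intro that[of p]) (auto simp: graded_prime_ideal_def)
qed

section \<open>Radical ideals as intersections of graded primes\<close>

text \<open>A component of \<open>x\<close> with no positive power in \<open>I\<close> would be
  avoided by some graded prime over \<open>I\<close>, although \<open>x\<close> lies in all of them.
  When there are none, \<open>\<Inter>{}\<close> is the whole type and the factor
  \<open>carrier R\<close> cuts it back to the ring.\<close>

lemma graded_radical_ideal_eq_Inter_graded_V:
  assumes "graded_radical_ideal G R A I"
  shows "I = carrier R \<inter> \<Inter>(graded_V G R A I)"
proof (intro equalityI subsetI)
  have gr: "graded_ideal G R A I" and rad: "I = graded_radical G R A I"
    using assms by (auto simp: graded_radical_ideal_def)
  interpret I: ideal I R using gr by (simp add: graded_ideal_def)
  show "x \<in> carrier R \<inter> \<Inter>(graded_V G R A I)" if "x \<in> I" for x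
    using that by (auto simp: graded_V_def intro: I.a_Hcarr)
  fix x assume x: "x \<in> carrier R \<inter> \<Inter>(graded_V G R A I)"
  have cI: "\<exists>n>0. component G R A x g [^]\<^bsub>R\<^esub> (n::nat) \<in> I" if g: "g \<in> carrier G" for g
  proof (rule ccontr)
    assume no: "\<not> ?thesis"
    have hom: "component G R A x g \<in> homogeneous G A"
      using x g component_mem by (auto simp: homogeneous_def)
    obtain p where p: "graded_prime_ideal G R A p" "I \<subseteq> p" "component G R A x g \<notin> p"
      using graded_prime_avoiding_powers[OF gr hom] no by blast
    then have "x \<in> p" using x by (auto simp: graded_V_def graded_Spec_def)
    then show False using p g by (simp add: graded_prime_ideal_def graded_ideal_iff)
  qed
  then show "x \<in> I"
    using x by (subst rad) (simp add: graded_radical_def)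
qed

section \<open>Noetherian induction on closed sets\<close>

text \<open>The smallest graded ideal \<open>K\<close> over \<open>S\<close> lies in the same graded
  primes as \<open>S\<close>. This allows cutting a closed set by a single element.\<close>

lemma closedin_zariski_superset:
  assumes "S \<subseteq> carrier R"
  shows "closedin (zariski_topology G R A) {p \<in> graded_Spec G R A. S \<subseteq> p}"
proof -
  define K where "K = \<Inter>{K. graded_ideal G R A K \<and> S \<subseteq> K}"
  have "graded_ideal G R A K"
    unfolding K_def using assms graded_ideal_carrier by (intro graded_ideal_Inter) auto
  moreover have "{p \<in> graded_Spec G R A. S \<subseteq> p} = graded_V G R A K"
    unfolding graded_V_def graded_Spec_def graded_prime_ideal_def K_def by blast
  ultimately show ?thesis
    by (auto simp: closedin_zariski_topology)
qed

text \<open>This plays the role of the decomposition into finitely many irreducible components, with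
  members of \<open>P\<close> as generic points.\<close>

lemma noetherian_zariski_finite_lower_set:
  assumes noeth: "noetherian_space (zariski_topology G R A)"
    and C: "closedin (zariski_topology G R A) C"
  obtains P where "finite P" "P \<subseteq> C" "\<And>q. q \<in> C \<Longrightarrow> \<exists>p\<in>P. p \<subseteq> q"
proof -
  define covered where
    "covered C \<longleftrightarrow> (\<exists>P. finite P \<and> P \<subseteq> C \<and> (\<forall>q\<in>C. \<exists>p\<in>P. p \<subseteq> q))" for C :: "'r set set"
  define bad where "bad C \<longleftrightarrow> closedin (zariski_topology G R A) C \<and> \<not> covered C" for C
  have step: "\<exists>D. bad D \<and> D \<subset> C" if "bad C" for C
  proof -
    have cl: "closedin (zariski_topology G R A) C" and nc: "\<not> covered C"
      using that by (auto simp: bad_def)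
    obtain J where J: "C = graded_V G R A J"
      using cl by (auto simp: closedin_zariski_topology)
    have "C \<noteq> {}" using nc by (auto simp: covered_def)
    have prime: "graded_prime_ideal G R A p" if "p \<in> C" for p
      using that J by (simp add: graded_V_def graded_Spec_def)
    then have gr: "graded_ideal G R A (\<Inter>C)"
      using \<open>C \<noteq> {}\<close> by (intro graded_ideal_Inter) (auto simp: graded_prime_ideal_def)
    have sub: "\<Inter>C \<subseteq> carrier R"
      using gr unfolding graded_ideal_def
      by (meson additive_subgroup.a_subset ideal.axioms(1))
    have "\<not> graded_prime_ideal G R A (\<Inter>C)"
    proof
      assume "graded_prime_ideal G R A (\<Inter>C)"
      \<comment> \<open>Every member of \<open>C\<close> contains \<open>J\<close>, so the
        intersection does too; it then covers \<open>C\<close> alone.\<close>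
      then have "\<Inter>C \<in> C" using J by (auto simp: graded_V_def graded_Spec_def)
      then have "covered C" unfolding covered_def by (intro exI[of _ "{\<Inter>C}"]) auto
      with nc show False by blast
    qed
    moreover have "\<Inter>C \<noteq> carrier R"
    proof
      assume "\<Inter>C = carrier R"
      moreover obtain p where "p \<in> C" using \<open>C \<noteq> {}\<close> by blast
      moreover have "p \<subseteq> carrier R" using prime[OF \<open>p \<in> C\<close>]
        unfolding graded_prime_ideal_def graded_ideal_def
        by (meson additive_subgroup.a_subset ideal.axioms(1))
      ultimately show False using prime[OF \<open>p \<in> C\<close>] by (auto simp: graded_prime_ideal_def)
    qed
    ultimately obtain a b where ab: "a \<in> homogeneous G A" "b \<in> homogeneous G A"
      "a \<otimes>\<^bsub>R\<^esub> b \<in> \<Inter>C" "a \<notin> \<Inter>C" "b \<notin> \<Inter>C"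
      using gr by (auto simp: graded_prime_ideal_def)
    define D where "D x = C \<inter> {p \<in> graded_Spec G R A. {x} \<subseteq> p}" for x
    have D: "closedin (zariski_topology G R A) (D x)" if "x \<in> homogeneous G A" for x
      unfolding D_def using that homogeneous_closed
      by (intro closedin_Int cl closedin_zariski_superset) auto
    \<comment> \<open>Each prime in \<open>C\<close> contains the product of \<open>a\<close> and
      \<open>b\<close>, hence one of the factors.\<close>
    have C_eq: "C = D a \<union> D b"
      using ab prime by (auto simp: D_def graded_Spec_def graded_prime_ideal_def)
    have "\<not> (covered (D a) \<and> covered (D b))"
    proof
      assume "covered (D a) \<and> covered (D b)"
      then obtain P Q where "finite P" "P \<subseteq> D a" "\<forall>q\<in>D a. \<exists>p\<in>P. p \<subseteq> q"
        "finite Q" "Q \<subseteq> D b" "\<forall>q\<in>D b. \<exists>p\<in>Q. p \<subseteq> q"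
        unfolding covered_def by blast
      then have "covered C"
        unfolding covered_def C_eq by (intro exI[of _ "P \<union> Q"]) blast
      with nc show False by blast
    qed
    \<comment> \<open>Strict, since some member of \<open>C\<close> omits \<open>a\<close> and some
      member omits \<open>b\<close>.\<close>
    moreover have "D a \<subset> C" "D b \<subset> C"
      using ab(4,5) by (auto simp: D_def)
    ultimately show ?thesis
      using D ab(1,2) unfolding bad_def by blast
  qed
  have "covered C"
  proof (rule ccontr)
    assume "\<not> covered C"
    then have "bad C" using C by (simp add: bad_def)
    \<comment> \<open>Dependent choice turns \<open>step\<close> into a strictly descending sequence
      of closed sets.\<close>
    then have "\<exists>F. \<forall>n. bad (F n) \<and> F (Suc n) \<subset> F n"
      using step by (intro dependent_nat_choice) auto
    then obtain F where F: "\<And>n. bad (F n)" "\<And>n. F (Suc n) \<subset> F n" by blast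
    then have "\<exists>N. \<forall>n\<ge>N. F n = F N"
      using noeth unfolding noetherian_space_def bad_def by blast
    then obtain N where "F (Suc N) = F N" by (meson le_Suc_eq order_refl)
    with F(2) show False by blast
  qed
  then show ?thesis using that unfolding covered_def by blast
qed

end

section \<open>Selecting the minimal graded prime divisors\<close>

theorem theorem2p7:
  fixes G :: "('g, 'm) monoid_scheme"
    and R :: "('r, 'n) ring_scheme"
    and A :: "'g \<Rightarrow> 'r set"
    and I :: "'r set"
  assumes "graded_ring G R A"
    and "noetherian_space (zariski_topology G R A)"
    and "graded_radical_ideal G R A I"
  shows "\<exists>P. finite P \<and>
             (\<forall>p\<in>P. minimal_graded_prime_divisor G R A I p) \<and>
             I = carrier R \<inter> \<Inter>P"
proof -
  interpret graded_ring G R A by fact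
  let ?V = "graded_V G R A I"
  have "closedin (zariski_topology G R A) ?V"
    using assms(3) by (auto simp: graded_radical_ideal_def closedin_zariski_topology)
  then obtain P where P: "finite P" "P \<subseteq> ?V" "\<And>q. q \<in> ?V \<Longrightarrow> \<exists>p\<in>P. p \<subseteq> q"
    using noetherian_zariski_finite_lower_set[OF assms(2)] by blast
  define M where "M = {p \<in> P. minimal_graded_prime_divisor G R A I p}"
  have below: "\<exists>m\<in>M. m \<subseteq> q" if q: "q \<in> ?V" for q
  proof -
    obtain p where "p \<in> P" "p \<subseteq> q" using P(3)[OF q] by blast
    then obtain m where m: "m \<in> P" "m \<subseteq> p" "\<forall>r\<in>P. r \<subseteq> m \<longrightarrow> m = r"
      using finite_has_minimal2[OF P(1)] by metis
    \<comment> \<open>Minimality within \<open>P\<close> suffices: some \<open>r\<close> in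
      \<open>P\<close> lies below \<open>J\<close>, hence below \<open>m\<close>, which forces
      \<open>r = m\<close> and so \<open>J = m\<close>.\<close>
    have "J = m" if J: "J \<in> graded_Spec G R A" "I \<subseteq> J" "J \<subseteq> m" for J
    proof -
      have "J \<in> ?V" using J by (simp add: graded_V_def)
      then obtain r where "r \<in> P" "r \<subseteq> J" using P(3) by blast
      then show ?thesis using m(3) J(3) by blast
    qed
    then have "m \<in> M"
      using m(1) P(2) by (auto simp: M_def minimal_graded_prime_divisor_def)
    then show ?thesis using m(2) \<open>p \<subseteq> q\<close> by blast
  qed
  have "M \<subseteq> ?V" using P(2) by (auto simp: M_def)
  \<comment> \<open>If \<open>?V\<close> is empty then so is \<open>M\<close>, which matches the
    convention for the unit ideal.\<close>
  then have "\<Inter>M = \<Inter>?V" using below by blast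
  then have "I = carrier R \<inter> \<Inter>M"
    using graded_radical_ideal_eq_Inter_graded_V[OF assms(3)] by simp
  moreover have "finite M" using P(1) by (simp add: M_def)
  moreover have "\<forall>p\<in>M. minimal_graded_prime_divisor G R A I p" by (simp add: M_def)
  ultimately show ?thesis by blast
qed

end
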